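(* Let $\Delta$ be an edge-reflecting convex polytope, of full dimension, embedded in the $n$-dimensional real vector space $\mathfrak g^*$ by $\Phi$, with GKM one-skeleton $(\Gamma,\alpha)$, and assume that there is a lattice in $\mathfrak g^*$ such that the edges of $\Delta$ are scalar multiples of rational vectors. Then $$\dim H^2(\Gamma,\alpha)=b_2(\Gamma)+n,$$ where the summand $n$ is the contribution of the translations (constant maps $V_\Gamma\to\mathfrak g^*$). Thus the space of rational deformations of $\Phi$ modulo translations has dimension $b_2(\Gamma)$.
   Context: $\Gamma$ is the graph of vertices $V_\Gamma$ and edges of the polytope $\Delta$; $\Phi(p)\in\mathfrak g^*$ denotes the position of the vertex $p$. For an oriented edge from $p$ to $q$, the axial function is $\alpha_{pq}=\Phi(q)-\Phi(p)$. The pair $(\Gamma,\alpha)$ is the GKM one-skeleton of $\Delta$. Edge-reflecting: if two vertices $p$ and $q$ are joined by an edge $e$ of $\Delta$, then for every edge $e'\ne e$ containing $p$ there exists a unique edge $e''\neq e$ containing $q$ such that $e,e',e''$ are coplanar. $H^2(\Gamma,\alpha)$ is the space of maps $f:V_\Gamma\to\mathfrak g^*$ such that $f(q)-f(p)\in\mathbb R\,\alpha_{pq}$ for every edge $(p,q)$ of $\Gamma$. $b_2(\Gamma)$: choose $\xi\in\mathfrak g$ with $\alpha_{pq}(\xi)\neq0$ for all edges; $b_2(\Gamma)$ is the number of vertices $p$ for which exactly one edge $pq$ issuing from $p$ has $\alpha_{pq}(\xi)<0$; it does not depend on $\xi$. A function $f:V_\Gamma\to\mathfrak g^*$ is a rational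 deformation of $\Phi$ if there exists $\epsilon>0$ such that for every $t\in[0,\epsilon)$ the map $\Phi_t(p)=\Phi(p)+tf(p)$ is an embedding of $V_\Gamma$ and, for every oriented edge $pq$ of $\Gamma$, $\Phi_t(q)-\Phi_t(p)$ is a positive multiple of $\alpha_{pq}$. These form the vector space $H^2(\Gamma,\alpha)$. *)

theory Defs
  imports "HOL-Analysis.Analysis"
begin

(* The ambient space (the dual of g) is a type 'a :: euclidean_space of dimension n = DIM('a); its
   inner product is not used.  By double duality an element of g is a linear functional \<xi> on 'a,
   and the value of \<alpha> at \<xi> is written "\<xi> \<alpha>".
   The vertex set of \<Gamma> is a finite type 'v, placed in 'a by \<Phi>; maps from vertices to 'a that form
   a vector space are elements of the real vector space 'a ^ 'v. *)

definition edge_reflecting :: "'a::euclidean_space set \<Rightarrow> bool" where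
  "edge_reflecting \<Delta> \<longleftrightarrow>
     (\<forall>p q e. p extreme_point_of \<Delta> \<and> q extreme_point_of \<Delta> \<and> p \<noteq> q \<and>
              e edge_of \<Delta> \<and> e = closed_segment p q \<longrightarrow>
        (\<forall>e'. e' edge_of \<Delta> \<and> e' \<noteq> e \<and> p \<in> e' \<longrightarrow>
           (\<exists>!e''. e'' edge_of \<Delta> \<and> e'' \<noteq> e \<and> q \<in> e'' \<and> coplanar (e \<union> e' \<union> e''))))"

definition polytope_embedding :: "'a::euclidean_space set \<Rightarrow> ('v::finite \<Rightarrow> 'a) \<Rightarrow> bool" where
  "polytope_embedding \<Delta> \<Phi> \<longleftrightarrow> inj \<Phi> \<and> range \<Phi> = {x. x extreme_point_of \<Delta>}"

definition graph_edge :: "'a::euclidean_space set \<Rightarrow> ('v::finite \<Rightarrow> 'a) \<Rightarrow> 'v \<Rightarrow> 'v \<Rightarrow> bool" where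
  "graph_edge \<Delta> \<Phi> p q \<longleftrightarrow> closed_segment (\<Phi> p) (\<Phi> q) edge_of \<Delta>"

definition axial :: "('v::finite \<Rightarrow> 'a::euclidean_space) \<Rightarrow> 'v \<Rightarrow> 'v \<Rightarrow> 'a" where
  "axial \<Phi> p q = \<Phi> q - \<Phi> p"

definition full_lattice :: "'a::euclidean_space set \<Rightarrow> bool" where
  "full_lattice L \<longleftrightarrow>
     (\<exists>B. independent B \<and> span B = UNIV \<and>
          L = {\<Sum>b\<in>B. of_int (c b) *\<^sub>R b | c :: 'a \<Rightarrow> int. True})"

definition rational_vector :: "'a::euclidean_space set \<Rightarrow> 'a \<Rightarrow> bool" where
  "rational_vector L v \<longleftrightarrow> (\<exists>m::nat. m > 0 \<and> of_nat m *\<^sub>R v \<in> L)"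

definition edges_rational :: "'a::euclidean_space set \<Rightarrow> ('v::finite \<Rightarrow> 'a) \<Rightarrow> bool" where
  "edges_rational \<Delta> \<Phi> \<longleftrightarrow>
     (\<exists>L. full_lattice L \<and>
        (\<forall>p q. graph_edge \<Delta> \<Phi> p q \<longrightarrow>
           (\<exists>(c::real) v. rational_vector L v \<and> axial \<Phi> p q = c *\<^sub>R v)))"

definition H2 :: "'a::euclidean_space set \<Rightarrow> ('v::finite \<Rightarrow> 'a) \<Rightarrow> ('a ^ 'v) set" where
  "H2 \<Delta> \<Phi> = {f. \<forall>p q. graph_edge \<Delta> \<Phi> p q \<longrightarrow> (\<exists>c::real. f $ q - f $ p = c *\<^sub>R axial \<Phi> p q)}"

definition polarizing :: "'a::euclidean_space set \<Rightarrow> ('v::finite \<Rightarrow> 'a) \<Rightarrow> ('a \<Rightarrow> real) \<Rightarrow> bool" where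
  "polarizing \<Delta> \<Phi> \<xi> \<longleftrightarrow>
     linear \<xi> \<and> (\<forall>p q. graph_edge \<Delta> \<Phi> p q \<longrightarrow> \<xi> (axial \<Phi> p q) \<noteq> 0)"

(* The number b_2(\<Gamma>) as computed from a polarizing \<xi>. *)
definition b2 :: "'a::euclidean_space set \<Rightarrow> ('v::finite \<Rightarrow> 'a) \<Rightarrow> ('a \<Rightarrow> real) \<Rightarrow> nat" where
  "b2 \<Delta> \<Phi> \<xi> = card {p. card {q. graph_edge \<Delta> \<Phi> p q \<and> \<xi> (axial \<Phi> p q) < 0} = 1}"

definition rational_deformations ::
    "'a::euclidean_space set \<Rightarrow> ('v::finite \<Rightarrow> 'a) \<Rightarrow> ('a ^ 'v) set" where
  "rational_deformations \<Delta> \<Phi> =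
     {f. \<exists>\<epsilon>>0. \<forall>t::real. 0 \<le> t \<and> t < \<epsilon> \<longrightarrow>
           inj (\<lambda>p. \<Phi> p + t *\<^sub>R (f $ p)) \<and>
           (\<forall>p q. graph_edge \<Delta> \<Phi> p q \<longrightarrow>
              (\<exists>c>0. (\<Phi> q + t *\<^sub>R (f $ q)) - (\<Phi> p + t *\<^sub>R (f $ p)) = c *\<^sub>R axial \<Phi> p q))}"

definition constant_maps :: "('a::euclidean_space ^ 'v::finite) set" where
  "constant_maps = {f. \<exists>c. \<forall>p. f $ p = c}"

(* V and W are subspaces with W \<subseteq> V, and V / W has dimension d: there is a d-element set B of
   representatives whose cosets are spanning and linearly independent in V / W. *)
definition quotient_has_dim :: "'b::real_vector set \<Rightarrow> 'b set \<Rightarrow> nat \<Rightarrow> bool" where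
  "quotient_has_dim V W d \<longleftrightarrow>
     subspace V \<and> subspace W \<and> W \<subseteq> V \<and>
     (\<exists>B. finite B \<and> card B = d \<and> B \<subseteq> V \<and>
          (\<forall>v\<in>V. \<exists>c. v - (\<Sum>b\<in>B. c b *\<^sub>R b) \<in> W) \<and>
          (\<forall>c. (\<Sum>b\<in>B. c b *\<^sub>R b) \<in> W \<longrightarrow> (\<forall>b\<in>B. c b = 0)))"

end

theory Submission
  imports Defs
begin

text \<open>
  Sweep the polytope by \<open>\<xi>\<close>, adding the vertices one at a time in increasing order. Extending a class \<open>f\<close>
  across a vertex \<open>p\<close> with descending edges to \<open>q\<^sub>1, \<dots>, q\<^sub>k\<close> means choosing \<open>f p\<close> on the \<open>k\<close> lines
  \<open>f q\<^sub>i + \<real> (\<Phi> q\<^sub>i - \<Phi> p)\<close>. Edge reflection makes the plane through two of these edges cut the graph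
  in a polygon with \<open>p\<close> as its highest vertex, so going round it through the vertices already treated
  shows that the two lines meet. Any three edges at \<open>p\<close> are linearly independent, hence all the lines
  pass through one point. Thus every class extends, with \<open>n\<close>, \<open>1\<close> or \<open>0\<close> degrees of freedom when \<open>k\<close> is
  \<open>0\<close>, \<open>1\<close> or at least \<open>2\<close>; and convexity leaves exactly one vertex with \<open>k = 0\<close>.
\<close>

subsection \<open>Parity and dimension\<close>

text \<open>Handshake argument: a new vertex adds its degree twice, once as its own degree and once
  spread over its neighbours. It later excludes a component with exactly one vertex of odd
  degree.\<close>

lemma even_sum_card_neighbours:
  assumes "finite C" and sym: "\<And>x y. R x y \<Longrightarrow> R y x" and irr: "\<And>x. \<not> R x x"
  shows "even (\<Sum>x\<in>C. card {y\<in>C. R x y})"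
  using assms(1)
proof (induction C rule: finite_induct)
  case (insert v C)
  have "card {y\<in>insert v C. R x y} = card {y\<in>C. R x y} + (if R x v then 1 else 0)" if "x \<in> C" for x
  proof (cases "R x v")
    case True
    then have "{y\<in>insert v C. R x y} = insert v {y\<in>C. R x y}" by auto
    then show ?thesis using True insert.hyps by simp
  next
    case False
    then have "{y\<in>insert v C. R x y} = {y\<in>C. R x y}" by auto
    then show ?thesis using False by simp
  qed
  then have "(\<Sum>x\<in>C. card {y\<in>insert v C. R x y}) = (\<Sum>x\<in>C. card {y\<in>C. R x y}) + (\<Sum>x\<in>C. if R x v then 1 else 0)"
    by (simp add: sum.distrib)
  moreover have "(\<Sum>x\<in>C. if R x v then 1 else (0::nat)) = card {y\<in>C. R v y}"
  proof -
    have "{y\<in>C. R v y} = C \<inter> {x. R x v}" using sym by auto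
    then show ?thesis using insert.hyps(1) by (simp add: sum.If_cases)
  qed
  moreover have "{y\<in>insert v C. R v y} = {y\<in>C. R v y}" using irr by auto
  ultimately show ?case using insert by simp
qed simp

text \<open>When a basis \<open>K\<close> of \<open>W\<close> is extended to a basis
  \<open>D\<close> of \<open>V\<close>, the added vectors span a complement of \<open>W\<close>.
  Rank-nullity and the quotient dimension both come from this complement.\<close>

lemma quotient_basis:
  fixes V W :: "'b::euclidean_space set"
  assumes V: "subspace V" and W: "subspace W" and "W \<subseteq> V"
  obtains B where "finite B" "B \<subseteq> V" "independent B" "dim V = card B + dim W"
    "span B \<inter> W = {0}" "\<And>v. v \<in> V \<Longrightarrow> \<exists>b\<in>span B. v - b \<in> W"
proof -
  obtain K where K: "finite K" "K \<subseteq> W" "independent K" "span K = W" "card K = dim W"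
    using basis_subspace_exists[OF W] by blast
  obtain D where D: "K \<subseteq> D" "D \<subseteq> V" "independent D" "V \<subseteq> span D"
    using maximal_independent_subset_extend[of K V] K \<open>W \<subseteq> V\<close> by blast
  have "finite D" using D(3) by (rule independent_imp_finite)
  have "span D = V" using D V by (simp add: span_subspace)
  have "card D = dim V" using D by (metis basis_card_eq_dim)
  let ?B = "D - K"
  have indB: "independent ?B" using D(3) by (rule independent_mono) auto
  show thesis
  proof
    show "finite ?B" "?B \<subseteq> V" "independent ?B" using \<open>finite D\<close> D indB by auto
    show "dim V = card ?B + dim W"
      using \<open>card D = dim V\<close> K D \<open>finite D\<close> by (metis card_Diff_subset card_mono le_add_diff_inverse2)
    have DU: "D = ?B \<union> K" using D by auto
    show "\<exists>b\<in>span ?B. v - b \<in> W" if "v \<in> V" for v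
    proof -
      have "v \<in> span (?B \<union> K)" using that D DU by auto
      then obtain x y where "x \<in> span ?B" "y \<in> span K" "v = x + y" unfolding span_Un by auto
      then show ?thesis using K by force
    qed
    have "span ?B \<inter> span K \<subseteq> {0}"
    proof -
      have "dim V = card ?B + card K"
        using \<open>dim V = card ?B + dim W\<close> K by simp
      have "dim {x + y |x y. x \<in> span ?B \<and> y \<in> span K} + dim (span ?B \<inter> span K) = dim (span ?B) + dim (span K)"
        by (rule dim_sums_Int) auto
      moreover have "{x + y |x y. x \<in> span ?B \<and> y \<in> span K} = V"
        using span_Un[of ?B K] DU \<open>span D = V\<close> by auto
      ultimately have "dim (span ?B \<inter> span K) = 0"
        using \<open>dim V = card ?B + card K\<close> indB K by (simp add: dim_eq_card_independent)
      then show ?thesis by (simp add: dim_eq_0)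
    qed
    then show "span ?B \<inter> W = {0}" using K(4) span_zero[of ?B] span_zero[of K] by auto
  qed
qed

text \<open>Rank-nullity on \<open>V\<close>: on a complement of the kernel, \<open>T\<close> is
  injective and already has the full image.\<close>

lemma dim_image_plus_dim_kernel:
  fixes V :: "'b::euclidean_space set" and T :: "'b \<Rightarrow> 'c::euclidean_space"
  assumes V: "subspace V" and T: "linear T"
  shows "dim V = dim (T ` V) + dim {x\<in>V. T x = 0}"
proof -
  let ?W = "{x\<in>V. T x = 0}"
  have W: "subspace ?W"
    using V T by (auto simp: subspace_def linear_0 linear_add linear_cmul)
  obtain B where B: "finite B" "B \<subseteq> V" "independent B" "dim V = card B + dim ?W"
    "span B \<inter> ?W = {0}" "\<And>v. v \<in> V \<Longrightarrow> \<exists>b\<in>span B. v - b \<in> ?W"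
    using quotient_basis[OF V W] by blast
  have BV: "span B \<subseteq> V" using B V by (simp add: span_minimal)
  have "inj_on T (span B)"
    unfolding linear_injective_on_subspace_0[OF T subspace_span]
    using B(5) BV by blast
  then have "dim (T ` span B) = dim (span B)"
    using T by (intro dim_image_eq) (auto simp: span_span)
  moreover have "T ` V = T ` span B"
  proof
    show "T ` V \<subseteq> T ` span B"
    proof
      fix y assume "y \<in> T ` V"
      then obtain v where "v \<in> V" "y = T v" by auto
      then obtain b where "b \<in> span B" "T (v - b) = 0" using B(6) by blast
      then show "y \<in> T ` span B" using T \<open>y = T v\<close> by (auto simp: linear_diff)
    qed
  qed (use BV in auto)
  ultimately show ?thesis using B(3,4) by (simp add: dim_eq_card_independent)
qed

lemma quotient_has_dimI:
  fixes V W :: "'b::euclidean_space set"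
  assumes "subspace V" "subspace W" "W \<subseteq> V" "dim V = d + dim W"
  shows "quotient_has_dim V W d"
proof -
  obtain B where B: "finite B" "B \<subseteq> V" "independent B" "dim V = card B + dim W"
    "span B \<inter> W = {0}" "\<And>v. v \<in> V \<Longrightarrow> \<exists>b\<in>span B. v - b \<in> W"
    using quotient_basis[OF assms(1-3)] by blast
  have "card B = d" using B assms by simp
  moreover have "\<exists>c. v - (\<Sum>b\<in>B. c b *\<^sub>R b) \<in> W" if "v \<in> V" for v
    using B(6)[OF that] unfolding span_finite[OF B(1)] by auto
  moreover have "\<forall>b\<in>B. c b = 0" if "(\<Sum>b\<in>B. c b *\<^sub>R b) \<in> W" for c
  proof -
    have "(\<Sum>b\<in>B. c b *\<^sub>R b) \<in> span B" by (intro span_sum span_scale span_base)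
    then have "(\<Sum>b\<in>B. c b *\<^sub>R b) = 0" using B(5) that by blast
    then show ?thesis using B(1,3) by (auto simp: dependent_finite)
  qed
  ultimately show ?thesis
    using B assms unfolding quotient_has_dim_def by blast
qed

subsection \<open>Edge-reflecting skeleta\<close>

text \<open>Convexity enters through \<open>exposed\<close>: a functional constant along the edge
  and strictly larger at all other vertices. In \<open>reflect\<close>, coplanarity is expressed by
  direction vectors.\<close>

locale reflecting_skeleton =
  fixes E :: "'v::finite \<Rightarrow> 'v \<Rightarrow> bool" and \<Phi> :: "'v \<Rightarrow> 'a::euclidean_space"
  assumes inj: "inj \<Phi>"
    and sym: "E p q \<Longrightarrow> E q p"
    and irrefl: "\<not> E p p"
    and exposed: "E p q \<Longrightarrow> \<exists>a. a \<bullet> axial \<Phi> p q = 0 \<and> (\<forall>v. v \<noteq> p \<longrightarrow> v \<noteq> q \<longrightarrow> a \<bullet> axial \<Phi> p v > 0)"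
    and reflect: "\<lbrakk>E p q; E p r; r \<noteq> q\<rbrakk> \<Longrightarrow>
      \<exists>s. E q s \<and> s \<noteq> p \<and> axial \<Phi> q s \<in> span {axial \<Phi> p q, axial \<Phi> p r}"
begin

section \<open>Independence of edge directions at a vertex\<close>

abbreviation \<alpha> where "\<alpha> p q \<equiv> axial \<Phi> p q"

lemma axial_nonzero: "E p q \<Longrightarrow> \<alpha> p q \<noteq> 0"
  using inj irrefl by (auto simp: axial_def inj_def)

text \<open>The functional exposing \<open>pq\<close> kills \<open>\<alpha> p q\<close> and is
  positive on \<open>\<alpha> p r\<close>, so it isolates \<open>t\<close>.\<close>

lemma two_independent:
  assumes "E p q" "E p r" "q \<noteq> r" "s *\<^sub>R \<alpha> p q + t *\<^sub>R \<alpha> p r = 0"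
  shows "s = 0 \<and> t = 0"
proof -
  obtain a where a: "a \<bullet> \<alpha> p q = 0" "a \<bullet> \<alpha> p r > 0"
    using exposed[OF assms(1)] assms irrefl by metis
  have "a \<bullet> (s *\<^sub>R \<alpha> p q + t *\<^sub>R \<alpha> p r) = 0" using assms by simp
  then have "t = 0" using a by (simp add: inner_simps)
  then show ?thesis using assms(4) axial_nonzero[OF assms(1)] by simp
qed

text \<open>The functional exposing \<open>pq\<close> recovers \<open>t\<close> up to a positive
  factor. Used also with \<open>q\<close> and \<open>r\<close> exchanged, this puts every vertex in
  the plane of two edges inside the cone they span.\<close>

lemma cone_coefficient_nonneg:
  assumes "E p q" "E p r" "q \<noteq> r" "\<alpha> p v = s *\<^sub>R \<alpha> p q + t *\<^sub>R \<alpha> p r"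
  shows "t \<ge> 0 \<and> (v \<noteq> p \<longrightarrow> v \<noteq> q \<longrightarrow> t > 0)"
proof -
  obtain a where a: "a \<bullet> \<alpha> p q = 0" "\<And>v. v \<noteq> p \<Longrightarrow> v \<noteq> q \<Longrightarrow> a \<bullet> \<alpha> p v > 0"
    using exposed[OF assms(1)] by metis
  have r: "a \<bullet> \<alpha> p r > 0" using a assms irrefl by metis
  have "a \<bullet> \<alpha> p v = t * (a \<bullet> \<alpha> p r)" using a assms by (simp add: inner_simps)
  moreover have "a \<bullet> \<alpha> p v \<ge> 0" using a(1) a(2)[of v]
    by (cases "v = p \<or> v = q") (auto simp: axial_def intro: less_imp_le)
  ultimately show ?thesis using a(2)[of v] r by (metis mult.commute mult_pos_neg not_less zero_less_mult_pos2)
qed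

text \<open>A third edge in the plane would be a strictly positive combination of the other two,
  while the functional exposing it vanishes on it and is positive on both of them.\<close>

lemma not_coplanar_edges:
  assumes "E p q" "E p r" "E p v" "q \<noteq> r" "v \<noteq> q" "v \<noteq> r"
  shows "\<alpha> p v \<notin> span {\<alpha> p q, \<alpha> p r}"
proof
  assume "\<alpha> p v \<in> span {\<alpha> p q, \<alpha> p r}"
  then obtain s t where st: "\<alpha> p v = s *\<^sub>R \<alpha> p q + t *\<^sub>R \<alpha> p r"
    by (auto simp: span_breakdown_eq) (metis add.commute diff_add_cancel)
  have "v \<noteq> p" using assms irrefl by auto
  have "t > 0" using cone_coefficient_nonneg[OF assms(1,2,4) st] assms \<open>v \<noteq> p\<close> by simp
  moreover have "s > 0" using cone_coefficient_nonneg[of p r q v t s] st assms \<open>v \<noteq> p\<close> by (simp add: add.commute)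
  moreover obtain a where a: "a \<bullet> \<alpha> p v = 0" "\<And>w. w \<noteq> p \<Longrightarrow> w \<noteq> v \<Longrightarrow> a \<bullet> \<alpha> p w > 0"
    using exposed[OF assms(3)] by metis
  moreover have "a \<bullet> \<alpha> p q > 0" "a \<bullet> \<alpha> p r > 0" using a(2) assms irrefl by metis+
  ultimately have "s * (a \<bullet> \<alpha> p q) + t * (a \<bullet> \<alpha> p r) > 0" by (simp add: add_pos_pos)
  then show False using st a(1) by (simp add: inner_simps)
qed

lemma three_independent:
  assumes "E p q" "E p r" "E p v" "q \<noteq> r" "v \<noteq> q" "v \<noteq> r"
    and "s *\<^sub>R \<alpha> p q + t *\<^sub>R \<alpha> p r + u *\<^sub>R \<alpha> p v = 0"
  shows "s = 0 \<and> t = 0 \<and> u = 0"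
proof -
  have "u = 0"
  proof (rule ccontr)
    assume "u \<noteq> 0"
    have "\<alpha> p v = inverse u *\<^sub>R (u *\<^sub>R \<alpha> p v)" using \<open>u \<noteq> 0\<close> by simp
    also have "u *\<^sub>R \<alpha> p v = (- s) *\<^sub>R \<alpha> p q + (- t) *\<^sub>R \<alpha> p r"
      using assms(7) by (simp add: eq_neg_iff_add_eq_0 algebra_simps)
    finally have "\<alpha> p v = inverse u *\<^sub>R ((- s) *\<^sub>R \<alpha> p q + (- t) *\<^sub>R \<alpha> p r)" .
    moreover have "inverse u *\<^sub>R ((- s) *\<^sub>R \<alpha> p q + (- t) *\<^sub>R \<alpha> p r) \<in> span {\<alpha> p q, \<alpha> p r}"
      by (intro span_scale span_add span_base) auto
    ultimately show False using not_coplanar_edges[OF assms(1-6)] by simp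
  qed
  then show ?thesis using two_independent[OF assms(1,2,4)] assms(7) by simp
qed

text \<open>Three such neighbours would give three independent vectors in a space spanned by two.
  The generators \<open>x\<close>, \<open>y\<close> are arbitrary because in
  \<open>polygon_path\<close> the plane is spanned at \<open>p\<close> while \<open>v\<close> runs
  round the polygon.\<close>

lemma card_coplanar_neighbours_le_2:
  assumes "\<And>w. w \<in> A \<Longrightarrow> E v w \<and> \<alpha> v w \<in> span {x, y}"
  shows "card A \<le> 2"
proof (rule ccontr)
  assume "\<not> card A \<le> 2"
  then have "3 \<le> card A" by simp
  then obtain T where "T \<subseteq> A" "card T = 3" by (metis obtain_subset_with_card_n)
  then obtain q r s where qrs: "q \<in> A" "r \<in> A" "s \<in> A" "q \<noteq> r" "s \<noteq> q" "s \<noteq> r"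
    by (auto simp: card_3_iff)
  have E: "E v q" "E v r" "E v s" using qrs assms by auto
  have neq: "\<alpha> v q \<noteq> \<alpha> v r" using qrs inj by (auto simp: axial_def inj_def)
  have ind: "independent {\<alpha> v q, \<alpha> v r}"
  proof -
    have "\<alpha> v q \<notin> span {\<alpha> v r}"
    proof
      assume "\<alpha> v q \<in> span {\<alpha> v r}"
      then obtain k where "\<alpha> v q = k *\<^sub>R \<alpha> v r" by (auto simp: span_singleton)
      then have "1 *\<^sub>R \<alpha> v q + (-k) *\<^sub>R \<alpha> v r = 0" by simp
      then show False using two_independent[OF E(1,2) qrs(4)] by fastforce
    qed
    then show ?thesis using axial_nonzero[OF E(2)] by (simp add: independent_insert)
  qed
  have ns: "\<alpha> v s \<notin> span {\<alpha> v q, \<alpha> v r}"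
    using not_coplanar_edges[OF E qrs(4-6)] .
  then have "independent (insert (\<alpha> v s) {\<alpha> v q, \<alpha> v r})" using ind by (simp add: independent_insertI)
  moreover have "insert (\<alpha> v s) {\<alpha> v q, \<alpha> v r} \<subseteq> span {x, y}" using assms qrs by auto
  ultimately have "card (insert (\<alpha> v s) {\<alpha> v q, \<alpha> v r}) \<le> card {x, y}"
    using independent_span_bound[of "{x, y}"] by blast
  moreover have "\<alpha> v s \<notin> {\<alpha> v q, \<alpha> v r}" using ns span_base by metis
  then have "card (insert (\<alpha> v s) {\<alpha> v q, \<alpha> v r}) = 3" using neq by simp
  moreover have "card {x, y} \<le> 2" by (simp add: card_insert_if)
  ultimately show False by simp
qed

text \<open>
  The edges lying in the plane through the edges \<open>pq\<^sub>1\<close>, \<open>pq\<^sub>2\<close> form a 2-regular graph near \<open>p\<close>. If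
  \<open>q\<^sub>1\<close> and \<open>q\<^sub>2\<close> lay in different components after removing \<open>p\<close>, the component of \<open>q\<^sub>1\<close> would have
  \<open>q\<^sub>1\<close> as its only vertex of odd degree.
\<close>
lemma polygon_path:
  assumes pq: "E p q1" "E p q2" "q1 \<noteq> q2"
  defines "U \<equiv> span {\<alpha> p q1, \<alpha> p q2}"
  shows "(\<lambda>v w. E v w \<and> \<alpha> v w \<in> U \<and> v \<noteq> p \<and> w \<noteq> p)\<^sup>*\<^sup>* q1 q2"
proof (rule ccontr)
  define R where "R v w \<longleftrightarrow> E v w \<and> \<alpha> v w \<in> U" for v w
  define S where "S v w \<longleftrightarrow> R v w \<and> v \<noteq> p \<and> w \<noteq> p" for v w
  define C where "C = {v. S\<^sup>*\<^sup>* q1 v}"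
  assume "\<not> (\<lambda>v w. E v w \<and> \<alpha> v w \<in> U \<and> v \<noteq> p \<and> w \<noteq> p)\<^sup>*\<^sup>* q1 q2"
  moreover have "S = (\<lambda>v w. E v w \<and> \<alpha> v w \<in> U \<and> v \<noteq> p \<and> w \<noteq> p)"
    by (auto simp: fun_eq_iff S_def R_def)
  ultimately have q2: "q2 \<notin> C" by (simp add: C_def)
  have sU: "subspace U" by (simp add: U_def)
  have axial_swap: "\<alpha> w v = - \<alpha> v w" for v w by (simp add: axial_def)
  have Rsym: "R w v" if "R v w" for v w
    using that sym[of v w] subspace_neg[OF sU, of "\<alpha> v w"] axial_swap[of w v] by (simp add: R_def)
  have Rirr: "\<not> R v v" for v using irrefl by (simp add: R_def)
  have Rp: "R p w \<longleftrightarrow> w = q1 \<or> w = q2" for w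
  proof
    assume "R p w" then show "w = q1 \<or> w = q2"
      using not_coplanar_edges[OF pq(1,2) _ pq(3), of w] by (auto simp: R_def U_def)
  qed (use pq in \<open>auto simp: R_def U_def span_base\<close>)
  \<comment> \<open>Reflection stays in the plane, because the two edges involved span a subspace of
    \<open>U\<close>.\<close>
  have R_next: "\<exists>s. R w s \<and> s \<noteq> v" if R: "R v w" "R v u" "u \<noteq> w" for u v w
  proof -
    obtain s where s: "E w s" "s \<noteq> v" "\<alpha> w s \<in> span {\<alpha> v w, \<alpha> v u}"
      using reflect[of v w u] R unfolding R_def by blast
    have "span {\<alpha> v w, \<alpha> v u} \<subseteq> U" using that sU by (intro span_minimal) (auto simp: R_def)
    then show ?thesis using s by (auto simp: R_def)
  qed
  \<comment> \<open>Every vertex reached has the edge of arrival and, by reflecting another plane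
    edge of its predecessor, a way onwards. For \<open>q1\<close> the predecessor is
    \<open>p\<close>, and the edge to \<open>q2\<close> is reflected.\<close>
  have R_two: "\<exists>u w. u \<noteq> w \<and> R v u \<and> R v w" if "S\<^sup>*\<^sup>* q1 v" for v
    using that
  proof (induction rule: rtranclp_induct)
    case base
    then show ?case using R_next[of p q1 q2] Rp Rsym pq by metis
  next
    case (step v w)
    then obtain u where "R v u" "u \<noteq> w" by metis
    moreover have "R v w" using step by (simp add: S_def)
    ultimately show ?case using R_next[of v w u] Rsym by metis
  qed
  have deg: "card {w. R v w} = 2" if "v \<in> C" for v
  proof -
    have "card {w. R v w} \<le> 2"
      by (rule card_coplanar_neighbours_le_2[of _ v "\<alpha> p q1" "\<alpha> p q2"]) (auto simp: R_def U_def)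
    moreover obtain u w where "u \<noteq> w" "R v u" "R v w" using R_two[of v] \<open>v \<in> C\<close>
      unfolding C_def by blast
    then have "{u, w} \<subseteq> {w. R v w}" "card {u, w} = 2" by auto
    then have "2 \<le> card {w. R v w}" using card_mono[of "{w. R v w}" "{u, w}"] by simp
    ultimately show ?thesis by simp
  qed
  have np: "v \<noteq> p" if "v \<in> C" for v
  proof -
    have "S\<^sup>*\<^sup>* q1 v" using that by (simp add: C_def)
    then show ?thesis using pq irrefl by (induction rule: rtranclp_induct) (auto simp: S_def)
  qed
  have nbr: "{w\<in>C. R v w} = {w. R v w} - {p}" if "v \<in> C" for v
  proof -
    have "w \<in> C" if "R v w" "w \<noteq> p" for w
    proof -
      have "S v w" using that np[OF \<open>v \<in> C\<close>] by (simp add: S_def)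
      then show ?thesis using \<open>v \<in> C\<close> by (auto simp: C_def)
    qed
    then show ?thesis using np by auto
  qed
  have "q1 \<in> C" by (simp add: C_def)
  have "card {w\<in>C. R q1 w} = 1"
    using nbr[OF \<open>q1 \<in> C\<close>] deg[OF \<open>q1 \<in> C\<close>] Rp Rsym[of p q1] by simp
  \<comment> \<open>In the plane \<open>p\<close> is adjacent only to \<open>q1\<close> and
    \<open>q2\<close>; since \<open>q2\<close> lies outside \<open>C\<close>, only \<open>q1\<close>
    loses a neighbour when \<open>p\<close> is removed.\<close>
  moreover have "card {w\<in>C. R v w} = 2" if "v \<in> C - {q1}" for v
  proof -
    have "\<not> R v p" using Rp Rsym[of v p] that q2 by auto
    then have "{w. R v w} - {p} = {w. R v w}" by auto
    then show ?thesis using nbr deg that by simp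
  qed
  ultimately have "(\<Sum>v\<in>C. card {w\<in>C. R v w}) = 1 + 2 * card (C - {q1})"
    using \<open>q1 \<in> C\<close> by (simp add: sum.remove[of C q1])
  moreover have "even (\<Sum>v\<in>C. card {w\<in>C. R v w})"
    by (rule even_sum_card_neighbours) (use Rsym Rirr in auto)
  ultimately show False by simp
qed

end

subsection \<open>Extending classes upwards\<close>

locale polarized_skeleton = reflecting_skeleton E \<Phi>
  for E :: "'v::finite \<Rightarrow> 'v \<Rightarrow> bool" and \<Phi> :: "'v \<Rightarrow> 'a::euclidean_space" +
  fixes \<xi> :: "'a \<Rightarrow> real"
  assumes linear_\<xi>: "linear \<xi>" and \<xi>_nonzero: "E p q \<Longrightarrow> \<xi> (\<alpha> p q) \<noteq> 0"
begin

definition down :: "'v \<Rightarrow> 'v set" where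
  "down p = {q. E p q \<and> \<xi> (\<alpha> p q) < 0}"

definition compatible_on :: "'v set \<Rightarrow> ('v \<Rightarrow> 'a) \<Rightarrow> bool" where
  "compatible_on S f \<longleftrightarrow> (\<forall>v\<in>S. \<forall>w\<in>S. E v w \<longrightarrow> (\<exists>c. f w - f v = c *\<^sub>R \<alpha> v w))"

section \<open>Walking round the polygon below its highest vertex\<close>

lemma \<xi>_axial: "\<xi> (\<alpha> p q) = \<xi> (\<Phi> q) - \<xi> (\<Phi> p)"
  using linear_\<xi> by (simp add: axial_def linear_diff)

text \<open>By \<open>cone_coefficient_nonneg\<close> the vertex lies in the cone of two descending
  edges, so \<open>\<xi>\<close> drops. Hence a path round the polygon that avoids \<open>p\<close>
  stays below \<open>p\<close>.\<close>

lemma polygon_below: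
  assumes "q1 \<in> down p" "q2 \<in> down p" "q1 \<noteq> q2" "v \<noteq> p" "\<alpha> p v \<in> span {\<alpha> p q1, \<alpha> p q2}"
  shows "\<xi> (\<Phi> v) < \<xi> (\<Phi> p)"
proof -
  have E: "E p q1" "E p q2" and neg: "\<xi> (\<alpha> p q1) < 0" "\<xi> (\<alpha> p q2) < 0"
    using assms by (auto simp: down_def)
  obtain s t where st: "\<alpha> p v = s *\<^sub>R \<alpha> p q1 + t *\<^sub>R \<alpha> p q2"
    using assms(5) by (auto simp: span_breakdown_eq) (metis add.commute diff_add_cancel)
  have "t \<ge> 0" using cone_coefficient_nonneg[OF E assms(3) st] by simp
  moreover have "s \<ge> 0" using cone_coefficient_nonneg[OF E(2,1), of v t s] assms(3) st by (simp add: add.commute)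
  moreover have "\<alpha> p v \<noteq> 0" using assms(4) inj by (auto simp: axial_def inj_def)
  then have "s \<noteq> 0 \<or> t \<noteq> 0" using st by auto
  moreover have "\<xi> (\<alpha> p v) = s * \<xi> (\<alpha> p q1) + t * \<xi> (\<alpha> p q2)"
    using st linear_\<xi> by (simp add: linear_add linear_cmul)
  ultimately have "\<xi> (\<alpha> p v) < 0" using neg
    by (smt (verit, best) mult_nonneg_nonpos mult_pos_neg)
  then show ?thesis by (simp add: \<xi>_axial)
qed

text \<open>Telescoping along \<open>polygon_path\<close>: the path runs below \<open>p\<close>,
  hence inside \<open>S\<close>, and each increment of \<open>f\<close> is a multiple of an edge
  direction in the plane.\<close>

lemma compatible_difference_in_span:
  assumes f: "compatible_on S f" and S: "{v. \<xi> (\<Phi> v) < \<xi> (\<Phi> p)} \<subseteq> S"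
    and q: "q1 \<in> down p" "q2 \<in> down p" "q1 \<noteq> q2"
  shows "f q2 - f q1 \<in> span {\<alpha> p q1, \<alpha> p q2}"
proof -
  let ?U = "span {\<alpha> p q1, \<alpha> p q2}"
  have E: "E p q1" "E p q2" using q by (auto simp: down_def)
  have "v \<noteq> p \<and> \<alpha> p v \<in> ?U \<and> f v - f q1 \<in> ?U"
    if "(\<lambda>v w. E v w \<and> \<alpha> v w \<in> ?U \<and> v \<noteq> p \<and> w \<noteq> p)\<^sup>*\<^sup>* q1 v" for v
    using that
  proof (induction rule: rtranclp_induct)
    case base
    show ?case using E irrefl by (auto simp: span_base span_zero)
  next
    case (step v w)
    have "\<alpha> p w = \<alpha> p v + \<alpha> v w" by (simp add: axial_def)
    then have w: "\<alpha> p w \<in> ?U" using step by (metis span_add)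
    have "v \<in> S" "w \<in> S" using polygon_below[OF q] step w S by auto
    then obtain c where "f w - f v = c *\<^sub>R \<alpha> v w" using f step by (auto simp: compatible_on_def)
    then have "f w - f v \<in> ?U" using step by (simp add: span_scale)
    then have "(f w - f v) + (f v - f q1) \<in> ?U" using step by (intro span_add) auto
    then show ?case using w step by simp
  qed
  then show ?thesis using polygon_path[OF E q(3)] by blast
qed

text \<open>
  The lines \<open>f q + \<real> \<alpha> p q\<close> meet pairwise because of the polygons spanned by pairs of descending edges.
  Pairwise meeting lines with linearly independent directions, three at a time, are concurrent.
\<close>
lemma compatible_extension:
  assumes f: "compatible_on S f" and S: "{v. \<xi> (\<Phi> v) < \<xi> (\<Phi> p)} \<subseteq> S"
  obtains x where "\<And>q. q \<in> down p \<Longrightarrow> \<exists>c. x - f q = c *\<^sub>R \<alpha> p q"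
proof -
  have dif: "\<exists>a b. f q2 - f q1 = a *\<^sub>R \<alpha> p q1 + b *\<^sub>R \<alpha> p q2"
    if "q1 \<in> down p" "q2 \<in> down p" "q1 \<noteq> q2" for q1 q2
    using compatible_difference_in_span[OF f S that]
    by (auto simp: span_breakdown_eq) (metis add.commute diff_add_cancel)
  consider "down p = {}" | q where "down p = {q}" | q r where "q \<in> down p" "r \<in> down p" "q \<noteq> r"
    by blast
  then show thesis
  proof cases
    case 1 then show ?thesis using that by simp
  next
    case 2 then show ?thesis using that[of "f q"] by (auto intro: exI[of _ 0])
  next
    case 3
    obtain a b where ab: "f r - f q = a *\<^sub>R \<alpha> p q + b *\<^sub>R \<alpha> p r" using dif[OF 3] by blast
    \<comment> \<open>\<open>x\<close> is the point where the lines through \<open>f q\<close> and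
      \<open>f r\<close> meet; \<open>xr\<close> is its expression on the second line.\<close>
    define x where "x = f q + a *\<^sub>R \<alpha> p q"
    have xr: "x = f r - b *\<^sub>R \<alpha> p r" using ab unfolding x_def by (metis add.commute add_diff_cancel_right' diff_add_cancel diff_diff_add)
    show ?thesis
    proof (rule that[of x])
      fix s assume s: "s \<in> down p"
      consider "s = q" | "s = r" | "s \<noteq> q" "s \<noteq> r" by blast
      then show "\<exists>c. x - f s = c *\<^sub>R \<alpha> p s"
      proof cases
        case 1 then show ?thesis by (auto simp: x_def)
      next
        case 2 then show ?thesis using xr by (auto intro: exI[of _ "-b"])
      next
        case 3
        obtain a1 b1 where 1: "f s - f q = a1 *\<^sub>R \<alpha> p q + b1 *\<^sub>R \<alpha> p s" using dif s \<open>q \<in> down p\<close> 3 by metis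
        obtain a2 b2 where 2: "f s - f r = a2 *\<^sub>R \<alpha> p r + b2 *\<^sub>R \<alpha> p s" using dif s \<open>r \<in> down p\<close> 3 by metis
        have xq: "x - f s = (a - a1) *\<^sub>R \<alpha> p q - b1 *\<^sub>R \<alpha> p s"
        proof -
          have "x - f s = a *\<^sub>R \<alpha> p q - (f s - f q)" by (simp add: x_def)
          then show ?thesis unfolding 1 by (simp add: algebra_simps)
        qed
        have "x - f s = (- b - a2) *\<^sub>R \<alpha> p r - b2 *\<^sub>R \<alpha> p s"
        proof -
          have "x - f s = - b *\<^sub>R \<alpha> p r - (f s - f r)" by (simp add: xr)
          then show ?thesis unfolding 2 by (simp add: algebra_simps)
        qed
        \<comment> \<open>Equating the descriptions of \<open>x - f s\<close> via \<open>q\<close>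
          and via \<open>r\<close> gives a relation among three edge directions at \<open>p\<close>.
          Its first coefficient must vanish, which leaves only a multiple of
          \<open>\<alpha> p s\<close>.\<close>
        then have "(a - a1) *\<^sub>R \<alpha> p q + (b + a2) *\<^sub>R \<alpha> p r + (b2 - b1) *\<^sub>R \<alpha> p s = 0"
          using xq by (simp add: algebra_simps)
        then have "a - a1 = 0"
          using three_independent[of p q r s "a - a1" "b + a2" "b2 - b1"] \<open>q \<in> down p\<close> \<open>r \<in> down p\<close> s \<open>q \<noteq> r\<close> 3
          by (auto simp: down_def)
        then show ?thesis using xq by (auto intro: exI[of _ "-b1"])
      qed
    qed
  qed
qed

section \<open>Dimension count for classes on lower sets\<close>

definition supported_classes :: "'v set \<Rightarrow> ('a ^ 'v) set" where
  "supported_classes S = {f. (\<forall>v. v \<notin> S \<longrightarrow> f $ v = 0) \<and> compatible_on S (($) f)}"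

definition index_weight :: "'v \<Rightarrow> nat" where
  "index_weight p = (if down p = {} then DIM('a) else if card (down p) = 1 then 1 else 0)"

lemma compatible_on_add: "compatible_on S f \<Longrightarrow> compatible_on S g \<Longrightarrow> compatible_on S (\<lambda>v. f v + g v)"
  unfolding compatible_on_def by (metis add_diff_add scaleR_add_left)

lemma compatible_on_scale: "compatible_on S f \<Longrightarrow> compatible_on S (\<lambda>v. k *\<^sub>R f v)"
  unfolding compatible_on_def by (metis scaleR_diff_right scaleR_scaleR)

lemma subspace_supported_classes: "subspace (supported_classes S)"
proof (rule subspaceI)
  show "0 \<in> supported_classes S"
    by (auto simp: supported_classes_def compatible_on_def intro: exI[of _ 0])
  show "x + y \<in> supported_classes S" if "x \<in> supported_classes S" "y \<in> supported_classes S" for x y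
    using that compatible_on_add[of S "($) x" "($) y"]
    by (simp add: supported_classes_def compatible_on_def)
  show "c *\<^sub>R x \<in> supported_classes S" if "x \<in> supported_classes S" for c x
    using that compatible_on_scale[of S "($) x" c]
    by (simp add: supported_classes_def compatible_on_def)
qed

text \<open>This set is the freedom in the value at \<open>p\<close> once all values below are zero.
  With no descending edge the condition is void and the whole space remains; two independent
  directions share only 0.\<close>

lemma dim_multiples_of_descending: "dim {x. \<forall>q\<in>down p. \<exists>c. x = c *\<^sub>R \<alpha> p q} = index_weight p"
proof -
  let ?L = "{x. \<forall>q\<in>down p. \<exists>c. x = c *\<^sub>R \<alpha> p q}"
  consider "down p = {}" | q where "down p = {q}" | q r where "q \<in> down p" "r \<in> down p" "q \<noteq> r"
    by blast
  then show ?thesis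
  proof cases
    case 1 then show ?thesis by (simp add: index_weight_def)
  next
    case 2
    then have "?L = span {\<alpha> p q}" by (auto simp: span_singleton)
    moreover have "\<alpha> p q \<noteq> 0" using 2 axial_nonzero by (auto simp: down_def)
    ultimately show ?thesis using 2 by (simp add: index_weight_def)
  next
    case 3
    have "x = 0" if "x \<in> ?L" for x
    proof -
      have "\<forall>q\<in>down p. \<exists>c. x = c *\<^sub>R \<alpha> p q" using that by simp
      then obtain c d where cd: "x = c *\<^sub>R \<alpha> p q" "x = d *\<^sub>R \<alpha> p r" using 3(1,2) by metis
      then have "c *\<^sub>R \<alpha> p q + (- d) *\<^sub>R \<alpha> p r = 0" by (metis add.right_inverse scaleR_minus_left)
      moreover have "E p q" "E p r" using 3 by (auto simp: down_def)
      ultimately show ?thesis using two_independent[of p q r c "-d"] 3(3) cd(1) by simp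
    qed
    then have "?L = {0}" by (auto intro: exI[of _ 0])
    moreover have "card (down p) \<noteq> 1" using 3 by (auto simp: card_1_singleton_iff)
    ultimately show ?thesis using 3 by (auto simp: index_weight_def)
  qed
qed

text \<open>Induction removing a highest vertex \<open>p\<close> of the lower set \<open>S\<close>.
  Restriction to the rest is onto by \<open>compatible_extension\<close>, its kernel consists of the
  classes supported at \<open>p\<close>, and rank-nullity adds \<open>index_weight p\<close>.
  Extension by zero keeps all classes in one Euclidean space, where \<open>T\<close> acts as
  restriction.\<close>

lemma dim_supported_classes:
  assumes "\<And>v w. v \<in> S \<Longrightarrow> \<xi> (\<Phi> w) < \<xi> (\<Phi> v) \<Longrightarrow> w \<in> S"
  shows "dim (supported_classes S) = (\<Sum>p\<in>S. index_weight p)"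
proof -
  have "finite S" by simp
  then show ?thesis using assms
  proof (induction S rule: finite_psubset_induct)
    case (psubset S)
    show ?case
    proof (cases "S = {}")
      case True
      then have "supported_classes S = {0}" by (auto simp: supported_classes_def compatible_on_def vec_eq_iff)
      then show ?thesis using True by simp
    next
      case False
      define m where "m = Max ((\<lambda>v. \<xi> (\<Phi> v)) ` S)"
      have "m \<in> (\<lambda>v. \<xi> (\<Phi> v)) ` S" unfolding m_def using False by (intro Max_in) auto
      then obtain p where p: "p \<in> S" "\<xi> (\<Phi> p) = m" by auto
      have max: "\<xi> (\<Phi> v) \<le> \<xi> (\<Phi> p)" if "v \<in> S" for v
        using Max_ge[of "(\<lambda>v. \<xi> (\<Phi> v)) ` S" "\<xi> (\<Phi> v)"] that p(2) by (simp add: m_def)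
      let ?S = "S - {p}"
      have below: "{v. \<xi> (\<Phi> v) < \<xi> (\<Phi> p)} \<subseteq> ?S" using psubset.prems[OF p(1)] by auto
      \<comment> \<open>Vertices at the same height as \<open>p\<close> are not adjacent to it, as
        \<open>\<xi>\<close> does not vanish on edges; so every neighbour of \<open>p\<close> in
        \<open>S\<close> is descending.\<close>
      have nbr: "w \<in> down p" if "w \<in> S" "E p w" for w
        using max[OF that(1)] \<xi>_nonzero[OF that(2)] that by (simp add: down_def \<xi>_axial)
      have downS: "down p \<subseteq> ?S" using below by (auto simp: down_def \<xi>_axial)
      have IH: "dim (supported_classes ?S) = (\<Sum>p\<in>?S. index_weight p)"
      proof (rule psubset.IH)
        show "?S \<subset> S" using p by auto
        fix v w assume vw: "v \<in> ?S" "\<xi> (\<Phi> w) < \<xi> (\<Phi> v)"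
        then have "w \<in> S" using psubset.prems[of v w] by simp
        moreover have "w \<noteq> p" using vw max[of v] by auto
        ultimately show "w \<in> ?S" by simp
      qed
      define T where "T f = (\<chi> v. if v = p then 0 else f $ v)" for f :: "'a ^ 'v"
      have T: "linear T" by (rule linearI) (auto simp: T_def vec_eq_iff)
      have compat: "compatible_on S f \<longleftrightarrow> compatible_on ?S f \<and> (\<forall>q\<in>down p. \<exists>c. f p - f q = c *\<^sub>R \<alpha> p q)"
        (is "?l \<longleftrightarrow> ?r") for f
      proof
        assume l: ?l
        have "\<exists>c. f p - f q = c *\<^sub>R \<alpha> p q" if q: "q \<in> down p" for q
        proof -
          obtain c where "f q - f p = c *\<^sub>R \<alpha> p q"
            using l q subsetD[OF downS q] p(1) unfolding compatible_on_def down_def by blast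
          then have "f p - f q = (- c) *\<^sub>R \<alpha> p q" by (metis minus_diff_eq scaleR_minus_left)
          then show ?thesis by blast
        qed
        then show ?r using l by (auto simp: compatible_on_def)
      next
        assume r: ?r
        show ?l unfolding compatible_on_def
        proof (intro ballI impI)
          fix v w assume vw: "v \<in> S" "w \<in> S" "E v w"
          consider "v = p" | "w = p" | "v \<noteq> p" "w \<noteq> p" by blast
          then show "\<exists>c. f w - f v = c *\<^sub>R \<alpha> v w"
          proof cases
            case 1
            then obtain c where "f p - f w = c *\<^sub>R \<alpha> p w" using r nbr vw by blast
            then have "f w - f v = (- c) *\<^sub>R \<alpha> v w" using 1 by (metis minus_diff_eq scaleR_minus_left)
            then show ?thesis by blast
          next
            case 2
            then obtain c where "f p - f v = c *\<^sub>R \<alpha> p v" using r nbr vw sym by blast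
            moreover have "\<alpha> p v = - \<alpha> v p" by (simp add: axial_def)
            ultimately have "f w - f v = (- c) *\<^sub>R \<alpha> v w" using 2 by simp
            then show ?thesis by blast
          next
            case 3 then show ?thesis using r vw by (auto simp: compatible_on_def)
          qed
        qed
      qed
      have cong: "compatible_on ?S (($) (T f)) \<longleftrightarrow> compatible_on ?S (($) f)" for f
        by (auto simp: compatible_on_def T_def)
      have image: "T ` supported_classes S = supported_classes ?S"
      proof
        show "T ` supported_classes S \<subseteq> supported_classes ?S"
          using compat cong by (auto simp: supported_classes_def T_def)
        show "supported_classes ?S \<subseteq> T ` supported_classes S"
        proof
          fix f assume f: "f \<in> supported_classes ?S"
          then have cf: "compatible_on ?S (($) f)" by (simp add: supported_classes_def)
          obtain x where x: "\<And>q. q \<in> down p \<Longrightarrow> \<exists>c. x - f $ q = c *\<^sub>R \<alpha> p q"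
            using compatible_extension[OF cf below] by blast
          define g where "g = (\<chi> v. if v = p then x else f $ v)"
          have Tg: "T g = f" using f by (auto simp: T_def g_def vec_eq_iff supported_classes_def)
          have "q \<noteq> p" if "q \<in> down p" for q using that downS by auto
          then have "compatible_on S (($) g)"
            unfolding compat cong[of g, symmetric] Tg using cf x by (auto simp: g_def)
          then have "g \<in> supported_classes S"
            using f p by (auto simp: supported_classes_def g_def)
          then show "f \<in> T ` supported_classes S" using Tg by blast
        qed
      qed
      let ?K = "{f\<in>supported_classes S. T f = 0}" and ?L = "{x. \<forall>q\<in>down p. \<exists>c. x = c *\<^sub>R \<alpha> p q}"
      have "dim ?K = index_weight p"
      proof -
        \<comment> \<open>The values at descending neighbours are zero here, so each condition at
          \<open>p\<close> places \<open>f $ p\<close> on a line through the origin.\<close>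
        have K: "f \<in> ?K \<longleftrightarrow> (\<forall>v. v \<noteq> p \<longrightarrow> f $ v = 0) \<and> f $ p \<in> ?L" for f
        proof -
          have T0: "T f = 0 \<longleftrightarrow> (\<forall>v. v \<noteq> p \<longrightarrow> f $ v = 0)" by (auto simp: T_def vec_eq_iff)
          have "f \<in> supported_classes S \<longleftrightarrow> f $ p \<in> ?L" if z: "\<forall>v. v \<noteq> p \<longrightarrow> f $ v = 0"
          proof -
            have "compatible_on ?S (($) f)" using z by (auto simp: compatible_on_def intro: exI[of _ 0])
            moreover have "\<forall>q\<in>down p. f $ q = 0" using z downS by auto
            ultimately show ?thesis using z p by (auto simp: supported_classes_def compat)
          qed
          then show ?thesis using T0 by auto
        qed
        define J where "J x = (\<chi> v. if v = p then x else 0)" for x :: 'a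
        have J: "linear J" by (rule linearI) (auto simp: J_def vec_eq_iff)
        have "?K = J ` ?L"
        proof
          show "?K \<subseteq> J ` ?L"
          proof
            fix f assume "f \<in> ?K"
            then have f: "\<forall>v. v \<noteq> p \<longrightarrow> f $ v = 0" "f $ p \<in> ?L" using K by blast+
            then have "f = J (f $ p)" by (auto simp: J_def vec_eq_iff)
            then show "f \<in> J ` ?L" using f by blast
          qed
          show "J ` ?L \<subseteq> ?K" unfolding subset_iff K by (auto simp: J_def)
        qed
        moreover have "J x $ p = x" for x by (simp add: J_def)
        then have "inj J" by (metis injI)
        then have "dim (J ` ?L) = dim ?L" using J by (intro dim_image_eq) (auto intro: inj_on_subset)
        ultimately show ?thesis using dim_multiples_of_descending by simp
      qed
      then have "dim (supported_classes S) = (\<Sum>p\<in>?S. index_weight p) + index_weight p"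
        using dim_image_plus_dim_kernel[OF subspace_supported_classes T, of S] image IH by simp
      then show ?thesis using p by (simp add: sum.remove[of S p])
    qed
  qed
qed

lemma dim_compatible:
  "dim {f :: 'a ^ 'v. \<forall>p q. E p q \<longrightarrow> (\<exists>c. f $ q - f $ p = c *\<^sub>R \<alpha> p q)} =
    DIM('a) * card {p. down p = {}} + card {p. card (down p) = 1}"
proof -
  have "{f :: 'a ^ 'v. \<forall>p q. E p q \<longrightarrow> (\<exists>c. f $ q - f $ p = c *\<^sub>R \<alpha> p q)} = supported_classes UNIV"
    by (auto simp: supported_classes_def compatible_on_def)
  moreover have "(\<Sum>p\<in>UNIV. index_weight p) =
      (\<Sum>p\<in>UNIV. (if down p = {} then DIM('a) else 0) + (if card (down p) = 1 then 1 else 0))"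
    by (intro sum.cong) (auto simp: index_weight_def)
  ultimately show ?thesis
    using dim_supported_classes[of UNIV] by (simp add: sum.distrib sum.If_cases)
qed

end

subsection \<open>Vertices and edges of polytopes\<close>

lemma edge_face: "graph_edge \<Delta> \<Phi> p q \<Longrightarrow> closed_segment (\<Phi> p) (\<Phi> q) face_of \<Delta>"
  by (simp add: graph_edge_def edge_of_def)

lemma graph_edge_sym: "graph_edge \<Delta> \<Phi> p q \<Longrightarrow> graph_edge \<Delta> \<Phi> q p"
  by (simp add: graph_edge_def closed_segment_commute)

lemma graph_edge_irrefl: "\<not> graph_edge \<Delta> \<Phi> p p"
  by (simp add: graph_edge_def edge_of_def)

lemma edge_eq_segment:
  assumes "polytope \<Delta>" "polytope_embedding \<Delta> \<Phi>" "e edge_of \<Delta>"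
  obtains p q where "e = closed_segment (\<Phi> p) (\<Phi> q)"
proof -
  have f: "e face_of \<Delta>" "aff_dim e = 1" using assms by (auto simp: edge_of_def)
  then have "polytope e" using assms face_of_polytope_polytope by blast
  then have "compact e" "convex e" by (auto simp: polytope_imp_compact polytope_imp_convex)
  moreover have "e \<noteq> {}" using f by auto
  moreover have "collinear e" using f by (simp add: collinear_aff_dim)
  ultimately obtain a b where e: "e = closed_segment a b" using compact_convex_collinear_segment by blast
  then have "a extreme_point_of e" "b extreme_point_of e" by (auto simp: extreme_point_of_segment)
  then have "a extreme_point_of \<Delta>" "b extreme_point_of \<Delta>" using f extreme_point_of_face by blast+
  then have "a \<in> range \<Phi>" "b \<in> range \<Phi>" using assms by (auto simp: polytope_embedding_def)
  then show thesis using that e by blast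
qed

lemma vertex_in_edge_segment:
  assumes "polytope \<Delta>" "polytope_embedding \<Delta> \<Phi>" "e edge_of \<Delta>" "\<Phi> q \<in> e"
  obtains s where "e = closed_segment (\<Phi> q) (\<Phi> s)" "graph_edge \<Delta> \<Phi> q s"
proof -
  obtain u w where e: "e = closed_segment (\<Phi> u) (\<Phi> w)" using edge_eq_segment assms by blast
  have "\<Phi> q extreme_point_of \<Delta>" using assms by (auto simp: polytope_embedding_def)
  then have "\<Phi> q extreme_point_of e"
    using assms extreme_point_of_face by (auto simp: edge_of_def)
  then have "\<Phi> q = \<Phi> u \<or> \<Phi> q = \<Phi> w" unfolding e by (simp add: extreme_point_of_segment)
  then show thesis
    using that e assms(3) by (metis closed_segment_commute graph_edge_def)
qed

text \<open>Faces of a polytope are exposed, and a vertex on the edge is one of its ends, so the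
  supporting functional is strict at all others. The sign in \<open>-a\<close> reverses
  \<open>a \<bullet> x \<le> b\<close>.\<close>

lemma graph_edge_exposed:
  fixes \<Phi> :: "'v::finite \<Rightarrow> 'a::euclidean_space"
  assumes "polytope \<Delta>" "polytope_embedding \<Delta> \<Phi>" "graph_edge \<Delta> \<Phi> p q"
  shows "\<exists>a. a \<bullet> axial \<Phi> p q = 0 \<and> (\<forall>v. v \<noteq> p \<longrightarrow> v \<noteq> q \<longrightarrow> a \<bullet> axial \<Phi> p v > 0)"
proof -
  let ?e = "closed_segment (\<Phi> p) (\<Phi> q)"
  have f: "?e face_of \<Delta>" using assms edge_face by blast
  have "?e exposed_face_of \<Delta>"
    using f assms by (simp add: exposed_face_of_polyhedron polytope_imp_polyhedron)
  then obtain a b where ab: "\<Delta> \<subseteq> {x. a \<bullet> x \<le> b}" "?e = \<Delta> \<inter> {x. a \<bullet> x = b}"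
    by (auto simp: exposed_face_of_def)
  have ext: "\<Phi> v extreme_point_of \<Delta>" for v using assms by (auto simp: polytope_embedding_def)
  have "\<Phi> p \<in> ?e" "\<Phi> q \<in> ?e" by auto
  then have pq: "a \<bullet> \<Phi> p = b" "a \<bullet> \<Phi> q = b" using ab by auto
  have "a \<bullet> \<Phi> v < b" if "v \<noteq> p" "v \<noteq> q" for v
  proof -
    have "\<Phi> v \<notin> ?e"
    proof
      assume "\<Phi> v \<in> ?e"
      then have "\<Phi> v extreme_point_of ?e" using f ext extreme_point_of_face by blast
      then have "\<Phi> v = \<Phi> p \<or> \<Phi> v = \<Phi> q" by (simp add: extreme_point_of_segment)
      then show False using assms that by (auto simp: polytope_embedding_def inj_def)
    qed
    moreover have "\<Phi> v \<in> \<Delta>" using ext by (simp add: extreme_point_of_def)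
    ultimately show ?thesis using ab by force
  qed
  then show ?thesis using pq by (intro exI[of _ "-a"]) (auto simp: axial_def inner_diff_right)
qed

text \<open>Independence makes the affine hull of \<open>p\<close>, \<open>q\<close>,
  \<open>r\<close> two-dimensional, so it fills the plane that contains \<open>C\<close>.\<close>

lemma coplanar_imp_diff_in_span:
  fixes p q r s :: "'a::euclidean_space"
  assumes "coplanar C" "{p, q, r, s} \<subseteq> C" "independent {q - p, r - p}" "q \<noteq> r"
  shows "s - q \<in> span {q - p, r - p}"
proof -
  let ?U = "span {q - p, r - p}"
  obtain u v w where C: "C \<subseteq> affine hull {u, v, w}" using assms(1) by (auto simp: coplanar_def)
  have hull: "affine hull {p, q, r} = (+) p ` ?U"
    using affine_hull_insert_span_gen[of p "{q, r}"] by (simp add: add.commute)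
  have "affine hull {p, q, r} = affine hull {u, v, w}"
  proof (rule affine_dim_equal)
    show sub: "affine hull {p, q, r} \<subseteq> affine hull {u, v, w}"
      using C assms(2) by (intro hull_minimal) auto
    have "aff_dim {u, v, w} \<le> int (card {u, v, w}) - 1" by (intro aff_dim_le_card) auto
    moreover have "card {u, v, w} \<le> 3" by (simp add: card_insert_if)
    moreover have "aff_dim {p, q, r} = 2"
    proof -
      have "aff_dim {p, q, r} = int (dim ((\<lambda>x. x - p) ` {p, q, r}))"
        by (rule aff_dim_eq_dim_subtract) (simp add: hull_inc)
      also have "dim ((\<lambda>x. x - p) ` {p, q, r}) = dim {q - p, r - p}"
        using dim_span[of "{0, q - p, r - p}"] dim_span[of "{q - p, r - p}"] by simp
      also have "\<dots> = 2" using assms(3,4) dim_eq_card_independent by fastforce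
      finally show ?thesis by simp
    qed
    moreover have "aff_dim {p, q, r} \<le> aff_dim {u, v, w}"
      using aff_dim_subset[OF sub] by simp
    ultimately show "aff_dim (affine hull {p, q, r}) = aff_dim (affine hull {u, v, w})" by simp
  qed auto
  then have "s \<in> (+) p ` ?U" using C assms(2) hull by auto
  then have "s - p \<in> ?U" by auto
  moreover have "q - p \<in> ?U" by (simp add: span_base)
  ultimately have "(s - p) - (q - p) \<in> ?U" by (rule span_diff)
  then show ?thesis by simp
qed

text \<open>The argument of \<open>two_independent\<close>, made directly for polytopes because it
  serves to establish \<open>reflect\<close>.\<close>

lemma graph_edges_independent:
  assumes "polytope \<Delta>" "polytope_embedding \<Delta> \<Phi>" "graph_edge \<Delta> \<Phi> p q" "graph_edge \<Delta> \<Phi> p r" "q \<noteq> r"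
  shows "independent {axial \<Phi> p q, axial \<Phi> p r}"
proof -
  have "inj \<Phi>" "q \<noteq> p" "r \<noteq> p"
    using assms graph_edge_irrefl by (auto simp: polytope_embedding_def)
  then have ne: "axial \<Phi> p q \<noteq> 0" "r \<noteq> p" by (auto simp: axial_def inj_def)
  obtain a where a: "a \<bullet> axial \<Phi> p q = 0" "a \<bullet> axial \<Phi> p r > 0"
    using graph_edge_exposed[OF assms(1-3)] assms(5) ne(2) by metis
  have "axial \<Phi> p r \<notin> span {axial \<Phi> p q}" using a by (auto simp: span_singleton)
  then have "independent (insert (axial \<Phi> p r) {axial \<Phi> p q})"
    using ne by (intro independent_insertI) (simp_all add: independent_insert independent_empty)
  then show ?thesis by (simp add: insert_commute)
qed

lemma graph_edge_reflect:
  assumes P: "polytope \<Delta>" "polytope_embedding \<Delta> \<Phi>" and refl: "edge_reflecting \<Delta>"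
    and E: "graph_edge \<Delta> \<Phi> p q" "graph_edge \<Delta> \<Phi> p r" "r \<noteq> q"
  shows "\<exists>s. graph_edge \<Delta> \<Phi> q s \<and> s \<noteq> p \<and> axial \<Phi> q s \<in> span {axial \<Phi> p q, axial \<Phi> p r}"
proof -
  let ?e = "closed_segment (\<Phi> p) (\<Phi> q)" and ?e' = "closed_segment (\<Phi> p) (\<Phi> r)"
  have inj: "inj \<Phi>" using P by (simp add: polytope_embedding_def)
  have ext: "\<Phi> v extreme_point_of \<Delta>" for v using P by (auto simp: polytope_embedding_def)
  have "p \<noteq> q" using E graph_edge_irrefl by auto
  have "?e' \<noteq> ?e"
  proof
    assume "?e' = ?e"
    moreover have "\<Phi> r extreme_point_of ?e'" by (subst extreme_point_of_segment) simp
    ultimately have "\<Phi> r extreme_point_of ?e" by metis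
    then have "\<Phi> r = \<Phi> p \<or> \<Phi> r = \<Phi> q" by (simp add: extreme_point_of_segment)
    then have "r = p \<or> r = q" using inj by (auto simp: inj_def)
    then show False using E graph_edge_irrefl by metis
  qed
  moreover have "\<Phi> p \<noteq> \<Phi> q" using \<open>p \<noteq> q\<close> inj by (auto simp: inj_def)
  moreover have "?e edge_of \<Delta>" "?e' edge_of \<Delta>" using E by (auto simp: graph_edge_def)
  moreover have "\<Phi> p \<in> ?e'" by simp
  ultimately have "\<exists>!e''. e'' edge_of \<Delta> \<and> e'' \<noteq> ?e \<and> \<Phi> q \<in> e'' \<and> coplanar (?e \<union> ?e' \<union> e'')"
    using refl[unfolded edge_reflecting_def, rule_format, of "\<Phi> p" "\<Phi> q" ?e ?e'] ext by blast
  then obtain e'' where e'': "e'' edge_of \<Delta>" "e'' \<noteq> ?e" "\<Phi> q \<in> e''" "coplanar (?e \<union> ?e' \<union> e'')" by blast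
  obtain s where s: "e'' = closed_segment (\<Phi> q) (\<Phi> s)" "graph_edge \<Delta> \<Phi> q s"
    using vertex_in_edge_segment[OF P e''(1,3)] by blast
  have "s \<noteq> p" using s e'' by (auto simp: closed_segment_commute)
  moreover have "\<Phi> s - \<Phi> q \<in> span {\<Phi> q - \<Phi> p, \<Phi> r - \<Phi> p}"
  proof (rule coplanar_imp_diff_in_span[OF e''(4)])
    show "independent {\<Phi> q - \<Phi> p, \<Phi> r - \<Phi> p}"
      using graph_edges_independent[OF P E(1,2)] E(3) by (simp add: axial_def)
    show "\<Phi> q \<noteq> \<Phi> r" using E inj by (auto simp: inj_def)
  qed (use s in auto)
  ultimately show ?thesis using s by (auto simp: axial_def)
qed

text \<open>Take a minimal face containing \<open>x\<close>. On its relative boundary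
  \<open>x\<close> would lie in a facet of it, a smaller face of \<open>P\<close>.\<close>

lemma minimal_face_in_rel_interior:
  fixes P :: "'a::euclidean_space set"
  assumes "polyhedron P" "x \<in> P"
  obtains F where "F face_of P" "x \<in> rel_interior F"
proof -
  let ?A = "{F. F face_of P \<and> x \<in> F}"
  have A: "finite ?A" using finite_polyhedron_faces[OF assms(1)] by (rule rev_finite_subset) auto
  have "P \<in> ?A" using assms by (simp add: face_of_refl polyhedron_imp_convex)
  then obtain F where F: "F \<in> ?A" "\<And>G. G \<in> ?A \<Longrightarrow> G \<subseteq> F \<Longrightarrow> G = F"
    using finite_has_minimal[OF A] by (metis empty_iff)
  have "x \<in> rel_interior F"
  proof (rule ccontr)
    assume "x \<notin> rel_interior F"
    moreover have "polyhedron F" using F assms face_of_polyhedron_polyhedron by blast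
    ultimately have "x \<in> \<Union> {G. G facet_of F}" using rel_boundary_of_polyhedron F by blast
    then obtain G where G: "G facet_of F" "x \<in> G" by blast
    then have "G face_of P" using F face_of_trans facet_of_imp_face_of by blast
    then have "G = F" using F G facet_of_imp_subset by blast
    then show False using G by simp
  qed
  then show thesis using that F by blast
qed

text \<open>\<open>y\<close> is relatively interior to the slice too, so being extreme there makes
  the slice a single point. A hyperplane section lowers the dimension by at most one.\<close>

lemma rel_interior_extreme_point_of_slice:
  fixes F :: "'a::euclidean_space set"
  assumes "convex F" "y \<in> rel_interior F" "y extreme_point_of (F \<inter> {x. a \<bullet> x = c})"
  shows "aff_dim F \<le> 1"
proof -
  let ?H = "{x. a \<bullet> x = c}"
  have y: "y \<in> F" "y \<in> ?H" using assms(3) by (auto simp: extreme_point_of_def)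
  have "rel_interior (F \<inter> ?H) = rel_interior F \<inter> ?H"
    using assms y by (intro convex_affine_rel_interior_Int) (auto simp: affine_hyperplane)
  then have "y \<in> rel_interior (F \<inter> ?H)" using assms y by simp
  then have slice: "F \<inter> ?H = {y}" using extreme_point_not_in_REL_INTERIOR assms(3) by blast
  obtain e where e: "e > 0" "ball y e \<inter> affine hull F \<subseteq> F"
    using assms(2) by (auto simp: mem_rel_interior_ball)
  \<comment> \<open>Moving from \<open>y\<close> slightly towards another point \<open>z\<close>
    would give a second point of the slice; \<open>t\<close> is scaled to a distance of
    \<open>e / 2\<close>.\<close>
  have "affine hull F \<inter> ?H \<subseteq> {y}"
  proof
    fix z assume z: "z \<in> affine hull F \<inter> ?H"
    show "z \<in> {y}"
    proof (rule ccontr)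
      assume "z \<notin> {y}"
      then have n: "norm (z - y) > 0" by simp
      define t where "t = e / (2 * norm (z - y))"
      define w where "w = (1 - t) *\<^sub>R y + t *\<^sub>R z"
      have wy: "w - y = t *\<^sub>R (z - y)" by (simp add: w_def algebra_simps)
      have "t > 0" using e n by (simp add: t_def)
      have "norm (w - y) = e / 2" unfolding wy using n e by (simp add: t_def)
      then have "w \<in> ball y e" using e by (simp add: dist_norm norm_minus_commute)
      moreover have "w \<in> affine hull F \<inter> ?H"
        unfolding w_def using z y
        by (intro mem_affine affine_Int affine_affine_hull affine_hyperplane) (auto simp: hull_inc)
      ultimately have "w \<in> F \<inter> ?H" using e by blast
      then have "w = y" using slice by blast
      then show False using wy \<open>t > 0\<close> n by simp
    qed
  qed
  then have "aff_dim (affine hull F \<inter> ?H) \<le> 0" using aff_dim_subset aff_dim_sing by metis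
  moreover have "y \<in> affine hull F \<inter> ?H" using y by (simp add: hull_inc)
  then have "aff_dim (affine hull F \<inter> ?H) \<ge> aff_dim F - 1"
    by (subst aff_dim_affine_Int_hyperplane) auto
  ultimately show ?thesis by simp
qed

text \<open>
  A hyperplane separating \<open>p\<close> from the other vertices cuts the polytope in a slice whose extreme points
  lie on edges issuing from \<open>p\<close>, and \<open>\<xi>\<close> takes a value at most \<open>\<xi> p\<close> at one of these.
\<close>
lemma monotone_neighbour:
  fixes \<Phi> :: "'v::finite \<Rightarrow> 'a::euclidean_space"
  assumes P: "polytope \<Delta>" "polytope_embedding \<Delta> \<Phi>" and \<xi>: "linear \<xi>"
    and v: "v \<noteq> p" "\<xi> (\<Phi> v) \<le> \<xi> (\<Phi> p)"
  obtains q where "graph_edge \<Delta> \<Phi> p q" "\<xi> (\<Phi> q) \<le> (\<xi> (\<Phi> p) :: real)"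
proof -
  have inj: "inj \<Phi>" using P by (simp add: polytope_embedding_def)
  have ext: "\<Phi> w extreme_point_of \<Delta>" for w using P by (auto simp: polytope_embedding_def)
  have in\<Delta>: "\<Phi> w \<in> \<Delta>" for w using ext by (simp add: extreme_point_of_def)
  have poly: "polyhedron \<Delta>" using P polytope_imp_polyhedron by blast
  have "{\<Phi> p} exposed_face_of \<Delta>"
    using ext by (simp add: exposed_face_of_polyhedron[OF poly] face_of_singleton)
  then obtain a b where ab: "\<Delta> \<subseteq> {x. a \<bullet> x \<le> b}" "{\<Phi> p} = \<Delta> \<inter> {x. a \<bullet> x = b}"
    by (auto simp: exposed_face_of_def)
  have ap: "a \<bullet> \<Phi> p = b" using ab by auto
  have lt: "a \<bullet> \<Phi> w < b" if "w \<noteq> p" for w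
  proof -
    have "\<Phi> w \<noteq> \<Phi> p" using that inj by (auto simp: inj_def)
    then have "a \<bullet> \<Phi> w \<noteq> b" using ab(2) in\<Delta> by blast
    then show ?thesis using ab(1) in\<Delta>[of w] by force
  qed
  define m where "m = Max ((\<lambda>w. a \<bullet> \<Phi> w) ` (- {p}))"
  have m: "a \<bullet> \<Phi> w \<le> m" if "w \<noteq> p" for w unfolding m_def using that by (intro Max_ge) auto
  have "m < b" unfolding m_def using v lt by (subst Max_less_iff) auto
  \<comment> \<open>A level strictly between \<open>p\<close> and all other vertices, so the slice
    contains no vertex.\<close>
  define c where "c = (m + b) / 2"
  have c: "m < c" "c < b" using \<open>m < b\<close> by (auto simp: c_def)
  let ?H = "{x. a \<bullet> x = c}"
  let ?S = "\<Delta> \<inter> ?H"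
  \<comment> \<open>The parameter at which the segment from \<open>p\<close> to \<open>v\<close>
    crosses the level \<open>c\<close>.\<close>
  define t where "t = (b - c) / (b - a \<bullet> \<Phi> v)"
  have t: "0 < t" "t < 1" using c m[OF v(1)] by (auto simp: t_def)
  define y0 where "y0 = (1 - t) *\<^sub>R \<Phi> p + t *\<^sub>R \<Phi> v"
  have "y0 \<in> \<Delta>" unfolding y0_def using t in\<Delta> polytope_imp_convex[OF P(1)] by (intro convexD) auto
  moreover have "a \<bullet> y0 = b - t * (b - a \<bullet> \<Phi> v)"
    by (simp add: y0_def inner_add_right ap algebra_simps)
  then have "a \<bullet> y0 = c" using c m[OF v(1)] by (simp add: t_def)
  ultimately have y0: "y0 \<in> ?S" by simp
  have "\<xi> y0 = \<xi> (\<Phi> p) - t * (\<xi> (\<Phi> p) - \<xi> (\<Phi> v))"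
    using \<xi> unfolding y0_def by (simp add: linear_add linear_cmul) (simp add: algebra_simps)
  then have \<xi>0: "\<xi> y0 \<le> \<xi> (\<Phi> p)" using t v by simp
  \<comment> \<open>The slice is the convex hull of its extreme points. If \<open>\<xi>\<close>
    exceeded \<open>\<xi> (\<Phi> p)\<close> at all of them, it would do so at
    \<open>y0\<close>.\<close>
  have "\<exists>y. y extreme_point_of ?S \<and> \<xi> y \<le> \<xi> (\<Phi> p)"
  proof (rule ccontr)
    assume "\<not> ?thesis"
    then have "{y. y extreme_point_of ?S} \<subseteq> {y. \<xi> y > \<xi> (\<Phi> p)}" by auto
    moreover have "convex {y. \<xi> y > \<xi> (\<Phi> p)}"
    proof -
      have "{y. \<xi> y > \<xi> (\<Phi> p)} = \<xi> -` {\<xi> (\<Phi> p)<..}" by auto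
      then show ?thesis using convex_linear_vimage[OF \<xi>] by simp
    qed
    ultimately have "convex hull {y. y extreme_point_of ?S} \<subseteq> {y. \<xi> y > \<xi> (\<Phi> p)}"
      by (rule hull_minimal)
    moreover have "?S = convex hull {y. y extreme_point_of ?S}"
      using P by (intro Krein_Milman_Minkowski compact_Int_closed convex_Int)
        (auto simp: polytope_imp_compact polytope_imp_convex closed_hyperplane convex_hyperplane)
    ultimately show False using y0 \<xi>0 by force
  qed
  then obtain y where y: "y extreme_point_of ?S" "\<xi> y \<le> \<xi> (\<Phi> p)" by blast
  have "y \<in> \<Delta>" "a \<bullet> y = c" using y by (auto simp: extreme_point_of_def)
  \<comment> \<open>This face is the edge sought: \<open>y\<close> is extreme in its slice, which
    bounds its dimension by 1, and no vertex has level \<open>c\<close>, which excludes dimension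
    0.\<close>
  obtain F where F: "F face_of \<Delta>" "y \<in> rel_interior F"
    using minimal_face_in_rel_interior[OF poly \<open>y \<in> \<Delta>\<close>] by blast
  have "y \<in> F" using F rel_interior_subset by blast
  have "F \<subseteq> \<Delta>" using F face_of_imp_subset by blast
  then have "y extreme_point_of (F \<inter> ?H)"
    using y(1) \<open>y \<in> F\<close> by (auto simp: extreme_point_of_def)
  then have "aff_dim F \<le> 1"
    using rel_interior_extreme_point_of_slice F face_of_imp_convex polytope_imp_convex[OF P(1)] by blast
  moreover have "aff_dim F \<noteq> 0"
  proof
    assume "aff_dim F = 0"
    then have "F = {y}" using \<open>y \<in> F\<close> by (auto simp: aff_dim_eq_0)
    then have "y extreme_point_of \<Delta>" using F by (simp add: face_of_singleton)
    then obtain w where "y = \<Phi> w" using P by (auto simp: polytope_embedding_def)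
    then show False using \<open>a \<bullet> y = c\<close> c m[of w] ap by (cases "w = p") auto
  qed
  moreover have "aff_dim F \<ge> 0" using \<open>y \<in> F\<close> by (metis aff_dim_negative_iff empty_iff not_less)
  ultimately have "F edge_of \<Delta>" using F by (simp add: edge_of_def)
  then obtain u w where uw: "F = closed_segment (\<Phi> u) (\<Phi> w)" using edge_eq_segment[OF P] by blast
  \<comment> \<open>With both ends different from \<open>p\<close>, the edge would stay at levels at
    most \<open>m\<close>, below \<open>c\<close>.\<close>
  have "\<Phi> p \<in> F"
  proof (rule ccontr)
    assume "\<Phi> p \<notin> F"
    then have "u \<noteq> p" "w \<noteq> p" using uw by auto
    then have "F \<subseteq> {x. a \<bullet> x \<le> m}"
      unfolding uw using m by (intro closed_segment_subset) (auto simp: convex_halfspace_le)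
    then show False using \<open>y \<in> F\<close> \<open>a \<bullet> y = c\<close> c by auto
  qed
  then obtain q where q: "F = closed_segment (\<Phi> p) (\<Phi> q)" "graph_edge \<Delta> \<Phi> p q"
    using vertex_in_edge_segment[OF P \<open>F edge_of \<Delta>\<close>] by blast
  obtain s where s: "y = (1 - s) *\<^sub>R \<Phi> p + s *\<^sub>R \<Phi> q" "0 \<le> s" "s \<le> 1"
    using \<open>y \<in> F\<close> q by (auto simp: in_segment)
  \<comment> \<open>Since \<open>y\<close> differs from \<open>\<Phi> p\<close> and
    \<open>\<xi>\<close> is affine along the edge, \<open>\<xi> y \<le> \<xi> (\<Phi> p)\<close>
    carries over to the far end.\<close>
  have "s \<noteq> 0" using s ap \<open>a \<bullet> y = c\<close> c by auto
  have "\<xi> y = \<xi> (\<Phi> p) + s * (\<xi> (\<Phi> q) - \<xi> (\<Phi> p))"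
    using \<xi> unfolding s(1) by (simp add: linear_add linear_cmul) (simp add: algebra_simps)
  then have "s * (\<xi> (\<Phi> q) - \<xi> (\<Phi> p)) \<le> 0" using y(2) by simp
  then have "\<xi> (\<Phi> q) \<le> \<xi> (\<Phi> p)" using s \<open>s \<noteq> 0\<close> by (simp add: mult_le_0_iff)
  then show thesis using that q by blast
qed

text \<open>By \<open>monotone_neighbour\<close> a vertex without descending edges lies strictly
  below all others, so a local minimum of \<open>\<xi>\<close> is global and unique. A minimum
  exists by finiteness.\<close>

lemma unique_source:
  fixes \<Phi> :: "'v::finite \<Rightarrow> 'a::euclidean_space"
  assumes P: "polytope \<Delta>" "polytope_embedding \<Delta> \<Phi>" and \<xi>: "polarizing \<Delta> \<Phi> \<xi>"
  shows "card {p. {q. graph_edge \<Delta> \<Phi> p q \<and> \<xi> (axial \<Phi> p q) < 0} = {}} = 1"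
proof -
  have lin: "linear \<xi>" and nz: "\<And>p q. graph_edge \<Delta> \<Phi> p q \<Longrightarrow> \<xi> (axial \<Phi> p q) \<noteq> 0"
    using \<xi> by (auto simp: polarizing_def)
  have ax: "\<xi> (axial \<Phi> p q) = \<xi> (\<Phi> q) - \<xi> (\<Phi> p)" for p q
    using lin by (simp add: axial_def linear_diff)
  have source: "\<xi> (\<Phi> p) < \<xi> (\<Phi> v)"
    if p: "{q. graph_edge \<Delta> \<Phi> p q \<and> \<xi> (axial \<Phi> p q) < 0} = {}" and v: "v \<noteq> p" for p v
  proof (rule ccontr)
    assume "\<not> ?thesis"
    then obtain q where q: "graph_edge \<Delta> \<Phi> p q" "\<xi> (\<Phi> q) \<le> \<xi> (\<Phi> p)"
      using monotone_neighbour[OF P lin v] by force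
    then have "\<xi> (axial \<Phi> p q) < 0" using nz[OF q(1)] ax[of p q] by simp
    then show False using p q by blast
  qed
  have "Min (range (\<lambda>v. \<xi> (\<Phi> v))) \<in> range (\<lambda>v. \<xi> (\<Phi> v))" by (intro Min_in) auto
  then obtain p where p: "\<xi> (\<Phi> p) = Min (range (\<lambda>v. \<xi> (\<Phi> v)))" by (metis imageE)
  have min: "\<xi> (\<Phi> p) \<le> \<xi> (\<Phi> v)" for v unfolding p by (intro Min_le) auto
  have "{p. {q. graph_edge \<Delta> \<Phi> p q \<and> \<xi> (axial \<Phi> p q) < 0} = {}} = {p}"
  proof (intro equalityI subsetI)
    fix v assume "v \<in> {p. {q. graph_edge \<Delta> \<Phi> p q \<and> \<xi> (axial \<Phi> p q) < 0} = {}}"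
    then show "v \<in> {p}" using source[of v p] min[of v] by fastforce
  next
    fix v assume "v \<in> {p}"
    then show "v \<in> {p. {q. graph_edge \<Delta> \<Phi> p q \<and> \<xi> (axial \<Phi> p q) < 0} = {}}"
      using min ax by (auto simp: not_less)
  qed
  then show ?thesis by simp
qed

subsection \<open>Deformations and translations\<close>

lemma subspace_H2: "subspace (H2 \<Delta> \<Phi>)"
proof (rule subspaceI)
  show "0 \<in> H2 \<Delta> \<Phi>" by (auto simp: H2_def intro: exI[of _ 0])
  show "x + y \<in> H2 \<Delta> \<Phi>" if "x \<in> H2 \<Delta> \<Phi>" "y \<in> H2 \<Delta> \<Phi>" for x y
    using that unfolding H2_def mem_Collect_eq vector_add_component
    by (metis add_diff_add scaleR_add_left)
  show "c *\<^sub>R x \<in> H2 \<Delta> \<Phi>" if "x \<in> H2 \<Delta> \<Phi>" for c x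
    using that unfolding H2_def mem_Collect_eq vector_scaleR_component
    by (metis scaleR_diff_right scaleR_scaleR)
qed

text \<open>One positive parameter already fixes the direction of each edge difference of
  \<open>f\<close>; conversely, a small enough deformation can neither merge vertices nor reverse an
  edge.\<close>

lemma rational_deformations_eq_H2:
  fixes \<Phi> :: "'v::finite \<Rightarrow> 'a::euclidean_space"
  assumes inj: "inj \<Phi>"
  shows "rational_deformations \<Delta> \<Phi> = H2 \<Delta> \<Phi>"
proof (intro equalityI subsetI)
  fix f assume "f \<in> rational_deformations \<Delta> \<Phi>"
  then obtain \<epsilon> where \<epsilon>: "\<epsilon> > 0" "\<And>t p q. 0 \<le> t \<Longrightarrow> t < \<epsilon> \<Longrightarrow> graph_edge \<Delta> \<Phi> p q \<Longrightarrow>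
      \<exists>c>0. (\<Phi> q + t *\<^sub>R (f $ q)) - (\<Phi> p + t *\<^sub>R (f $ p)) = c *\<^sub>R axial \<Phi> p q"
    unfolding rational_deformations_def by blast
  have "\<exists>c. f $ q - f $ p = c *\<^sub>R axial \<Phi> p q" if e: "graph_edge \<Delta> \<Phi> p q" for p q
  proof -
    define t where "t = \<epsilon> / 2"
    have t: "t > 0" "t < \<epsilon>" using \<epsilon>(1) by (auto simp: t_def)
    obtain c where "(\<Phi> q + t *\<^sub>R (f $ q)) - (\<Phi> p + t *\<^sub>R (f $ p)) = c *\<^sub>R axial \<Phi> p q"
      using \<epsilon>(2)[of t p q] t e by auto
    then have "t *\<^sub>R (f $ q - f $ p) = (c - 1) *\<^sub>R axial \<Phi> p q"
      by (simp add: axial_def algebra_simps)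
    then have "inverse t *\<^sub>R t *\<^sub>R (f $ q - f $ p) = (inverse t * (c - 1)) *\<^sub>R axial \<Phi> p q" by simp
    then show ?thesis using t by auto
  qed
  then show "f \<in> H2 \<Delta> \<Phi>" by (simp add: H2_def)
next
  fix f assume f: "f \<in> H2 \<Delta> \<Phi>"
  define M where "M = Max (range (\<lambda>(p, q). norm (f $ q - f $ p)))"
  \<comment> \<open>A lower bound for the distances between distinct vertices; the inserted 1 covers
    a single vertex, where there is no distance.\<close>
  define d where "d = Min (insert 1 ((\<lambda>(p, q). norm (\<Phi> q - \<Phi> p)) ` {(p, q). p \<noteq> q}))"
  have M: "norm (f $ q - f $ p) \<le> M" for p q
    unfolding M_def by (rule Max_ge) (auto intro!: range_eqI[of _ _ "(p, q)"])
  have d: "d > 0" "p \<noteq> q \<Longrightarrow> d \<le> norm (\<Phi> q - \<Phi> p)" for p q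
  proof -
    show "d > 0" unfolding d_def using inj by (subst Min_gr_iff) (auto simp: inj_def)
    show "p \<noteq> q \<Longrightarrow> d \<le> norm (\<Phi> q - \<Phi> p)"
      unfolding d_def by (rule Min_le) auto
  qed
  have M0: "M \<ge> 0" using M[of undefined undefined] by simp
  \<comment> \<open>The 1 added to \<open>M\<close> keeps the quotient meaningful when
    \<open>f\<close> is constant and \<open>M\<close> is 0.\<close>
  have small: "t * norm (f $ q - f $ p) < norm (\<Phi> q - \<Phi> p)"
    if t: "0 \<le> t" "t < d / (M + 1)" and "p \<noteq> q" for t p q
  proof -
    have "t * norm (f $ q - f $ p) \<le> t * (M + 1)" using t M[of q p] by (intro mult_left_mono) auto
    also have "\<dots> < d" using t M0 by (simp add: pos_less_divide_eq)
    also have "d \<le> norm (\<Phi> q - \<Phi> p)" using d that by simp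
    finally show ?thesis .
  qed
  show "f \<in> rational_deformations \<Delta> \<Phi>"
    unfolding rational_deformations_def mem_Collect_eq
  proof (rule exI[of _ "d / (M + 1)"], intro conjI allI impI)
    show "d / (M + 1) > 0" using d M0 by simp
    fix t :: real assume "0 \<le> t \<and> t < d / (M + 1)"
    then have t: "0 \<le> t" "t < d / (M + 1)" by auto
    show "inj (\<lambda>p. \<Phi> p + t *\<^sub>R (f $ p))"
    proof (rule injI, rule ccontr)
      fix p q assume eq: "\<Phi> p + t *\<^sub>R (f $ p) = \<Phi> q + t *\<^sub>R (f $ q)" and "p \<noteq> q"
      have "\<Phi> q - \<Phi> p = - (t *\<^sub>R (f $ q - f $ p))" using eq by (simp add: algebra_simps)
      then have "norm (\<Phi> q - \<Phi> p) = t * norm (f $ q - f $ p)" using t by simp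
      then show False using small[OF t \<open>p \<noteq> q\<close>] by simp
    qed
    fix p q assume e: "graph_edge \<Delta> \<Phi> p q"
    then have "p \<noteq> q" using graph_edge_irrefl by auto
    obtain c where c: "f $ q - f $ p = c *\<^sub>R axial \<Phi> p q" using f e by (auto simp: H2_def)
    \<comment> \<open>Both vectors compared in \<open>small\<close> are multiples of the same edge
      direction, so the bound becomes \<open>t * \<bar>c\<bar> < 1\<close> and the factor
      \<open>1 + t * c\<close> stays positive.\<close>
    then have "t * \<bar>c\<bar> * norm (axial \<Phi> p q) < 1 * norm (axial \<Phi> p q)"
      using small[OF t \<open>p \<noteq> q\<close>] by (simp add: axial_def)
    then have "t * \<bar>c\<bar> < 1" using mult_less_cancel_right_disj norm_ge_zero not_less by metis
    then have "\<bar>t * c\<bar> < 1" using t by (simp add: abs_mult)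
    then have "1 + t * c > 0" by linarith
    moreover have "(\<Phi> q + t *\<^sub>R (f $ q)) - (\<Phi> p + t *\<^sub>R (f $ p)) = (1 + t * c) *\<^sub>R axial \<Phi> p q"
    proof -
      have "(\<Phi> q + t *\<^sub>R (f $ q)) - (\<Phi> p + t *\<^sub>R (f $ p)) = axial \<Phi> p q + t *\<^sub>R (f $ q - f $ p)"
        by (simp add: axial_def algebra_simps)
      then show ?thesis unfolding c by (simp add: algebra_simps)
    qed
    ultimately show "\<exists>c>0. (\<Phi> q + t *\<^sub>R (f $ q)) - (\<Phi> p + t *\<^sub>R (f $ p)) = c *\<^sub>R axial \<Phi> p q" by blast
  qed
qed

section \<open>Translations\<close>

lemma constant_maps_eq_range: "constant_maps = range (\<lambda>x. \<chi> v. x)"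
  by (auto simp: constant_maps_def vec_eq_iff image_def)

lemma linear_constant_map: "linear (\<lambda>x. (\<chi> v. x) :: 'a::euclidean_space ^ 'v::finite)"
  by (rule linearI) (auto simp: vec_eq_iff)

lemma subspace_constant_maps: "subspace (constant_maps :: ('a::euclidean_space ^ 'v::finite) set)"
  unfolding constant_maps_eq_range using linear_constant_map by (rule linear_subspace_image) simp

lemma dim_constant_maps: "dim (constant_maps :: ('a::euclidean_space ^ 'v::finite) set) = DIM('a)"
proof -
  have "inj (\<lambda>x. (\<chi> v. x) :: 'a ^ 'v)" by (auto simp: inj_def vec_eq_iff)
  then show ?thesis
    unfolding constant_maps_eq_range using dim_image_eq[OF linear_constant_map, of UNIV]
    by (simp add: span_UNIV)
qed

subsection \<open>The dimension formula\<close>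

theorem mainTheorem8:
  fixes \<Delta> :: "'a::euclidean_space set"
    and \<Phi> :: "'v::finite \<Rightarrow> 'a"
    and \<xi> :: "'a \<Rightarrow> real"
  assumes "polytope \<Delta>"
    and "aff_dim \<Delta> = int DIM('a)"
    and "edge_reflecting \<Delta>"
    and "polytope_embedding \<Delta> \<Phi>"
    and "edges_rational \<Delta> \<Phi>"
    and "polarizing \<Delta> \<Phi> \<xi>"
  shows "subspace (H2 \<Delta> \<Phi>) \<and> dim (H2 \<Delta> \<Phi>) = b2 \<Delta> \<Phi> \<xi> + DIM('a) \<and>
         (constant_maps :: ('a ^ 'v) set) \<subseteq> H2 \<Delta> \<Phi> \<and>
         dim (constant_maps :: ('a ^ 'v) set) = DIM('a) \<and>
         quotient_has_dim (rational_deformations \<Delta> \<Phi>) constant_maps (b2 \<Delta> \<Phi> \<xi>)"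
proof -
  note P = \<open>polytope \<Delta>\<close> \<open>polytope_embedding \<Delta> \<Phi>\<close>
  have inj: "inj \<Phi>" using P by (simp add: polytope_embedding_def)
  interpret polarized_skeleton "graph_edge \<Delta> \<Phi>" \<Phi> \<xi>
  proof (intro polarized_skeleton.intro polarized_skeleton_axioms.intro reflecting_skeleton.intro)
    show "inj \<Phi>" by fact
    show "linear \<xi>" "\<And>p q. graph_edge \<Delta> \<Phi> p q \<Longrightarrow> \<xi> (axial \<Phi> p q) \<noteq> 0"
      using assms by (auto simp: polarizing_def)
  qed (fact graph_edge_sym graph_edge_irrefl graph_edge_exposed[OF P]
      graph_edge_reflect[OF P \<open>edge_reflecting \<Delta>\<close>])+
  have "dim (H2 \<Delta> \<Phi>) = DIM('a) * card {p. down p = {}} + card {p. card (down p) = 1}"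
    unfolding H2_def by (rule dim_compatible)
  \<comment> \<open>\<open>unique_source\<close> reduces the first term to \<open>DIM('a)\<close>;
    the second counts the vertices of \<open>b2\<close>.\<close>
  then have dim: "dim (H2 \<Delta> \<Phi>) = b2 \<Delta> \<Phi> \<xi> + DIM('a)"
    using unique_source[OF P \<open>polarizing \<Delta> \<Phi> \<xi>\<close>] by (simp add: b2_def down_def)
  have sub: "(constant_maps :: ('a ^ 'v) set) \<subseteq> H2 \<Delta> \<Phi>"
    by (auto simp: constant_maps_def H2_def intro: exI[of _ 0])
  have "quotient_has_dim (H2 \<Delta> \<Phi>) constant_maps (b2 \<Delta> \<Phi> \<xi>)"
    using dim dim_constant_maps[where 'a = 'a and 'v = 'v]
    by (intro quotient_has_dimI subspace_H2 subspace_constant_maps sub) simp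
  then show ?thesis
    using dim sub subspace_H2 dim_constant_maps rational_deformations_eq_H2[OF inj] by metis
qed

end
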